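(* Let $n\ge 1$ and let $x_1,\ldots,x_n$ be distinct positive real numbers. Let $X=[1+x_ix_j]_{i,j=1}^n$, and let $r$ be a nonnegative real number. Then the matrix $X^{\circ r}=[(1+x_ix_j)^r]_{i,j=1}^n$ is positive semidefinite if and only if $r$ is a nonnegative integer or $r>n-2$.
   Context: For a matrix $A=[a_{ij}]$ with positive entries and a real number $r\ge 0$, the $r$th Hadamard power of $A$ is the entrywise power $A^{\circ r}=[a_{ij}^r]$. *)

theory Defs
  imports "HOL-Analysis.Analysis"
begin

text \<open>Intended for matrices with positive entries: there \<open>powr\<close> is the usual real power,
  also for exponent 0. (At base 0, \<open>powr\<close> always returns 0.)\<close>

definition hadamard_power :: "real ^ 'n ^ 'm \<Rightarrow> real \<Rightarrow> real ^ 'n ^ 'm" where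
  "hadamard_power A r = (\<chi> i j. (A $ i $ j) powr r)"

text \<open>Symmetry is part of the notion; it does not follow from the quadratic form over the reals.\<close>

definition positive_semidefinite :: "real ^ 'n ^ 'n \<Rightarrow> bool" where
  "positive_semidefinite A \<longleftrightarrow> transpose A = A \<and> (\<forall>v. 0 \<le> v \<bullet> (A *v v))"

end

theory Submission
  imports Defs "HOL-Computational_Algebra.Polynomial"
begin

text \<open>For \<open>0 < s \<le> 1\<close> let \<open>M\<^sub>s\<close> have entries \<open>(1 + s x\<^sub>i x\<^sub>j)\<^sup>r\<close>. Unless
  \<open>r \<in> {0, \<dots>, n - 2}\<close>, a nontrivial combination of the \<open>n\<close> functions
  \<open>z \<mapsto> (1 + z x\<^sub>j)\<^sup>r\<close> has fewer than \<open>n\<close> positive zeros (Rolle's theorem and induction on \<open>n\<close>), so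
  every \<open>M\<^sub>s\<close> is nonsingular. Along the path \<open>s \<mapsto> M\<^sub>s\<close> positive semidefiniteness therefore cannot
  change, and it may be tested for small \<open>s\<close>. There the binomial series gives
  \<open>v \<bullet> M\<^sub>s v = (\<Sum>k. (r gchoose k) s\<^sup>k p\<^sub>k(v)\<^sup>2)\<close> with \<open>p\<^sub>k(v) = (\<Sum>i. v\<^sub>i x\<^sub>i\<^sup>k)\<close>, and the values
  \<open>p\<^sub>k(v)\<close> for \<open>k < n\<close> can be prescribed arbitrarily. If \<open>r > n - 2\<close> is not an integer, the first
  \<open>n\<close> coefficients are positive; if \<open>r < n - 2\<close> is not an integer, the coefficient with
  \<open>k = \<lfloor>r\<rfloor> + 2 < n\<close> is negative.\<close>

section \<open>Zeros of combinations of powers\<close>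

text \<open>Induction on the largest zero: Rolle's theorem on the last gap gives a point beyond
  \<open>Max A\<close>, hence outside the previous \<open>W\<close>. Differentiability is assumed on
  the whole ray from \<open>Min Z\<close>, a condition that does not change when a larger zero is
  added.\<close>

lemma Rolle_card_zeros:
  fixes g g' :: "real \<Rightarrow> real"
  assumes "finite Z" "Z \<noteq> {}"
    and "\<And>z. Min Z \<le> z \<Longrightarrow> (g has_real_derivative g' z) (at z)"
    and "\<And>z. z \<in> Z \<Longrightarrow> g z = 0"
  shows "\<exists>W. finite W \<and> Suc (card W) = card Z \<and> W \<subseteq> {Min Z..Max Z} \<and> (\<forall>w\<in>W. g' w = 0)"
  using assms
proof (induction Z rule: finite_linorder_max_induct)
  case empty
  then show ?case by simp
next
  case (insert b A)
  show ?case
  proof (cases "A = {}")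
    case True
    then show ?thesis by (intro exI[of _ "{}"]) auto
  next
    case False
    have lt: "Max A < b" and le: "Min A \<le> Max A" using insert.hyps False by auto
    have Min: "Min (insert b A) = Min A"
      unfolding Min_insert[OF insert.hyps(1) False] using lt le by (intro min_absorb2) linarith
    have Max: "Max (insert b A) = b"
      unfolding Max_insert[OF insert.hyps(1) False] using lt by (intro max_absorb1) linarith
    obtain W where W: "finite W" "Suc (card W) = card A" "W \<subseteq> {Min A..Max A}" "\<forall>w\<in>W. g' w = 0"
      using insert.IH[OF False] insert.prems Min by auto
    have "continuous_on {Max A..b} g"
      by (rule DERIV_continuous_on[where D = g'], rule has_field_derivative_at_within,
          rule insert.prems(2)) (use le Min in auto)
    moreover have "(g has_derivative (*) (g' z)) (at z)" if "Max A < z" for z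
      unfolding has_field_derivative_def[symmetric]
      by (rule insert.prems(2)) (use that le Min in linarith)
    moreover have "g (Max A) = g b" using insert.prems(3) insert.hyps(1) False by simp
    ultimately obtain z where z: "Max A < z" "z < b" "(*) (g' z) = (\<lambda>v. 0)"
      using Rolle_deriv[OF lt, of g "\<lambda>z. (*) (g' z)"] by blast
    have "g' z = 0" using fun_cong[OF z(3), of 1] by simp
    moreover have "z \<notin> W" using W(3) z(1) by auto
    moreover have "b \<notin> A" using insert.hyps by auto
    moreover have "insert z W \<subseteq> {Min A..b}"
      using W(3) z(1,2) le lt by fastforce
    ultimately show ?thesis
      using W(1,2,4) insert.hyps(1) unfolding Min Max
      by (intro exI[of _ "insert z W"]) simp
  qed
qed

text \<open>Dividing by \<open>(1 + z * b a) powr r\<close> and differentiating removes the term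
  \<open>a\<close>, lowers the exponent to \<open>r - 1\<close> and costs one zero by Rolle. The new
  coefficients carry the factor \<open>r\<close>; the excluded exponents are those for which this
  factor would vanish at some stage.\<close>

lemma powr_combination_zeros:
  fixes b c :: "'a \<Rightarrow> real"
  assumes "finite J" "inj_on b J" "\<And>j. j \<in> J \<Longrightarrow> b j > 0"
    and "finite Z" "card J \<le> card Z" "\<And>z. z \<in> Z \<Longrightarrow> z > 0"
    and "\<And>k. k + 2 \<le> card J \<Longrightarrow> r \<noteq> real k"
    and "\<And>z. z \<in> Z \<Longrightarrow> (\<Sum>j\<in>J. c j * (1 + z * b j) powr r) = 0"
    and "j \<in> J"
  shows "c j = 0"
  using assms
proof (induction J arbitrary: r c Z j rule: finite_induct)
  case empty
  then show ?case by simp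
next
  case (insert a J)
  note b = insert.prems(2)
  have ne: "Z \<noteq> {}" using insert.prems(3,4) insert.hyps by auto
  have J0: "c i = 0" if "i \<in> J" for i
  proof -
    have "0 + 2 \<le> card (insert a J)"
      using that insert.hyps by (simp add: Suc_le_eq card_gt_0_iff) blast
    then have r0: "r \<noteq> 0" using insert.prems(6)[of 0] by simp
    \<comment> \<open>The derivative of \<open>(1 + z * b j) / (1 + z * b a)\<close> has the
      numerator \<open>b j - b a\<close>, free of \<open>z\<close>. Hence \<open>g\<close> has as
      derivative a combination \<open>h\<close> of the same type times a factor without positive
      zeros.\<close>
    define h where "h = (\<lambda>z. (\<Sum>j\<in>J. (c j * (b j - b a) * r) * (1 + z * b j) powr (r - 1)))"
    define g where "g = (\<lambda>z. (\<Sum>j\<in>insert a J. c j * ((1 + z * b j) / (1 + z * b a)) powr r))"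
    have deriv: "(g has_real_derivative h z * (1 + z * b a) powr (- r - 1)) (at z)" if "z > 0" for z
    proof -
      have pos: "1 + z * b j > 0" if "j \<in> insert a J" for j
        using b[OF that] \<open>z > 0\<close> by (simp add: add_pos_pos)
      have "((\<lambda>z. c j * ((1 + z * b j) / (1 + z * b a)) powr r) has_real_derivative
         (c j * (b j - b a) * r) * (1 + z * b j) powr (r - 1) * (1 + z * b a) powr (- r - 1)) (at z)"
        if j: "j \<in> insert a J" for j
      proof -
        define u w where "u = 1 + z * b j" and "w = 1 + z * b a"
        have uw: "u > 0" "w > 0" using pos[OF j] pos[of a] by (auto simp: u_def w_def)
        have num: "b j * w - u * b a = b j - b a" by (simp add: u_def w_def algebra_simps)
        have e: "(u / w) powr (r - 1) / (w * w) = u powr (r - 1) * w powr (- r - 1)"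
        proof -
          have "w powr (r - 1) * (w * w) = w powr (r - 1) * w powr 2"
            using uw by (simp add: powr_numeral power2_eq_square)
          also have "\<dots> = w powr (r + 1)" by (simp add: add.commute flip: powr_add)
          finally have "(u / w) powr (r - 1) / (w * w) = u powr (r - 1) / w powr (r + 1)"
            using uw by (simp add: powr_divide)
          also have "\<dots> = u powr (r - 1) * w powr (- r - 1)"
            using powr_minus_divide[of w "r + 1"] by simp
          finally show ?thesis .
        qed
        have "((\<lambda>z. (1 + z * b j) / (1 + z * b a)) has_real_derivative (b j * w - u * b a) / (w * w)) (at z)"
          using uw by (auto intro!: derivative_eq_intros simp: u_def w_def)
        then have "((\<lambda>z. ((1 + z * b j) / (1 + z * b a)) powr r) has_real_derivative
             r * (u / w) powr (r - 1) * ((b j - b a) / (w * w))) (at z)"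
          using DERIV_chain2[where f = "\<lambda>y. y powr r" and Da = "r * (u / w) powr (r - 1)"
              and g = "\<lambda>z. (1 + z * b j) / (1 + z * b a)" and x = z and s = UNIV
              and Db = "(b j - b a) / (w * w)"]
            has_real_derivative_powr[of "u / w" r] uw
          unfolding num by (simp add: u_def w_def)
        then have "((\<lambda>z. c j * ((1 + z * b j) / (1 + z * b a)) powr r) has_real_derivative
             c j * (r * (u / w) powr (r - 1) * ((b j - b a) / (w * w)))) (at z)"
          by (rule DERIV_cmult)
        moreover have "c j * (r * (u / w) powr (r - 1) * ((b j - b a) / (w * w)))
            = c j * (b j - b a) * r * ((u / w) powr (r - 1) / (w * w))" by simp
        ultimately show ?thesis unfolding e by (simp add: u_def w_def mult.assoc)
      qed
      then have "(g has_real_derivative (\<Sum>j\<in>insert a J. (c j * (b j - b a) * r) *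
          (1 + z * b j) powr (r - 1) * (1 + z * b a) powr (- r - 1))) (at z)"
        unfolding g_def by (intro DERIV_sum) auto
      then show ?thesis using insert.hyps by (simp add: h_def sum_distrib_right)
    qed
    have Zpos: "Min Z > 0" using insert.prems(3,5) ne by simp
    have g0: "g z = 0" if z: "z \<in> Z" for z
    proof -
      have "g z = (\<Sum>j\<in>insert a J. c j * (1 + z * b j) powr r) / (1 + z * b a) powr r"
        unfolding g_def sum_divide_distrib using b insert.prems(5)[OF z]
        by (intro sum.cong refl) (simp add: powr_divide add_nonneg_nonneg less_imp_le)
      then show ?thesis using insert.prems(7)[OF z] by simp
    qed
    obtain W where W: "finite W" "Suc (card W) = card Z" "W \<subseteq> {Min Z..Max Z}"
        "\<forall>w\<in>W. h w * (1 + w * b a) powr (- r - 1) = 0"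
      using Rolle_card_zeros[OF insert.prems(3) ne, of g "\<lambda>z. h z * (1 + z * b a) powr (- r - 1)"]
        deriv g0 Zpos by (auto simp del: mult_eq_0_iff)
    have Wpos: "w > 0" if "w \<in> W" for w using that W(3) Zpos by fastforce
    have h0: "h w = 0" if "w \<in> W" for w
    proof -
      have "1 + w * b a > 0" using b[of a] Wpos[OF that] by (simp add: add_pos_pos)
      then show ?thesis using W(4) that by auto
    qed
    have "c i * (b i - b a) * r = 0"
    proof (rule insert.IH[where Z = W and r = "r - 1" and c = "\<lambda>j. c j * (b j - b a) * r" and j = i])
      show "inj_on b J" using insert.prems(1) by simp
      show "card J \<le> card W" using W(2) insert.prems(4) insert.hyps by simp
      show "r - 1 \<noteq> real k" if "k + 2 \<le> card J" for k
        using insert.prems(6)[of "Suc k"] that insert.hyps by auto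
      show "(\<Sum>j\<in>J. (c j * (b j - b a) * r) * (1 + w * b j) powr (r - 1)) = 0" if "w \<in> W" for w
        using h0[OF that] by (simp add: h_def)
    qed (use b W(1) Wpos that in auto)
    moreover have "b i \<noteq> b a" using inj_onD[OF insert.prems(1), of i a] insert.hyps that by auto
    ultimately show ?thesis using r0 by simp
  qed
  obtain z where z: "z \<in> Z" using ne by auto
  have "1 + z * b a > 0" using b[of a] insert.prems(5)[OF z] by (simp add: add_pos_pos)
  moreover have "c a * (1 + z * b a) powr r = 0"
    using insert.prems(7)[OF z] insert.hyps J0 by simp
  ultimately have "c a = 0" by simp
  then show ?case using J0 insert.prems(8) by auto
qed

section \<open>Positive semidefinite matrices along a path\<close>

text \<open>Put \<open>w = A *v v\<close>. Moving from \<open>v\<close> to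
  \<open>v - e *\<^sub>R w\<close> changes the form by \<open>- 2 * e * (w \<bullet> w)\<close> to
  first order, so a nonzero \<open>w\<close> would make it negative.\<close>

lemma positive_semidefinite_null:
  fixes A :: "real ^ 'n ^ 'n"
  assumes "positive_semidefinite A" and "v \<bullet> (A *v v) = 0"
  shows "A *v v = 0"
proof (rule ccontr)
  define w where "w = A *v v"
  assume "A *v v \<noteq> 0"
  then have w: "w \<bullet> w > 0" by (simp add: w_def)
  have sym: "v \<bullet> (A *v w) = w \<bullet> w"
    using assms(1) dot_lmul_matrix[of v A w] transpose_matrix_vector[of A v]
    by (simp add: positive_semidefinite_def w_def)
  define d where "d = w \<bullet> (A *v w)"
  have q: "0 \<le> e\<^sup>2 * d - 2 * e * (w \<bullet> w)" for e
  proof -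
    have "0 \<le> (v - e *\<^sub>R w) \<bullet> (A *v (v - e *\<^sub>R w))"
      using assms(1) by (simp add: positive_semidefinite_def)
    also have "A *v (v - e *\<^sub>R w) = w - e *\<^sub>R (A *v w)"
      by (simp add: matrix_vector_mult_diff_distrib matrix_vector_mult_scaleR w_def)
    also have "(v - e *\<^sub>R w) \<bullet> \<dots> = e\<^sup>2 * d - 2 * e * (w \<bullet> w)"
      using assms(2) sym by (simp add: inner_diff_left inner_diff_right d_def w_def power2_eq_square algebra_simps)
    finally show ?thesis .
  qed
  have d: "d \<ge> 0" using assms(1) by (simp add: positive_semidefinite_def d_def)
  \<comment> \<open>Negativity needs \<open>e * d < 2 * (w \<bullet> w)\<close>; the
    \<open>+ 1\<close> keeps the denominator positive when \<open>d = 0\<close>.\<close>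
  define e where "e = (w \<bullet> w) / (d + 1)"
  have "e > 0" "e * d < 2 * (w \<bullet> w)"
    using w d by (auto simp: e_def field_simps intro!: add_nonneg_pos)
  then have "e * (e * d - 2 * (w \<bullet> w)) < 0" by (intro mult_pos_neg) auto
  then show False using q[of e] by (simp add: power2_eq_square algebra_simps)
qed

lemma quadratic_form_sphere:
  fixes A :: "real ^ 'n ^ 'n"
  assumes "\<And>v. v \<in> sphere 0 1 \<Longrightarrow> v \<bullet> (A *v v) \<ge> 0"
  shows "v \<bullet> (A *v v) \<ge> 0"
proof (cases "v = 0")
  case False
  have "0 \<le> (v /\<^sub>R norm v) \<bullet> (A *v (v /\<^sub>R norm v))"
    using False by (intro assms) simp
  then show ?thesis using False
    by (simp add: matrix_vector_mult_scaleR zero_le_mult_iff)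
qed simp

text \<open>The interval is connected, and both the parameters with a semidefinite matrix and the
  remaining ones form closed sets. For the latter: a nonsingular semidefinite matrix is positive
  definite, so failure means a nonpositive value on the unit sphere, a closed condition by
  compactness.\<close>

lemma positive_semidefinite_path:
  fixes M :: "real \<Rightarrow> real ^ 'n ^ 'n"
  assumes "a \<le> b" and cont: "continuous_on {a..b} M"
    and sym: "\<And>s. s \<in> {a..b} \<Longrightarrow> transpose (M s) = M s"
    and nonsing: "\<And>s v. s \<in> {a..b} \<Longrightarrow> M s *v v = 0 \<Longrightarrow> v = 0"
  shows "positive_semidefinite (M a) \<longleftrightarrow> positive_semidefinite (M b)"
proof -
  let ?S = "sphere (0 :: real ^ 'n) 1"
  define q where "q = (\<lambda>p. snd p \<bullet> (M (fst p) *v snd p))"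
  have q: "continuous_on ({a..b} \<times> UNIV) q"
    unfolding q_def matrix_vector_mult_def inner_vec_def
    by (auto intro!: continuous_intros continuous_on_compose2[OF cont])
  define P where "P = {s \<in> {a..b}. positive_semidefinite (M s)}"
  have P: "P = {a..b} \<inter> (\<Inter>v. {s \<in> {a..b}. 0 \<le> q (s, v)})"
    using sym by (auto simp: P_def positive_semidefinite_def q_def)
  have "closed {s \<in> {a..b}. 0 \<le> q (s, v)}" for v
  proof -
    have "continuous_on {a..b} (\<lambda>s. q (s, v))"
      by (intro continuous_on_compose2[OF q] continuous_intros) auto
    from continuous_closed_preimage[OF this closed_atLeastAtMost closed_atLeast[of 0]]
    show ?thesis by (simp add: vimage_def Int_def)
  qed
  then have clP: "closed P" unfolding P by (intro closed_Int closed_INT ballI) auto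
  \<comment> \<open>The weak inequality makes \<open>N\<close> compact, so its projection is closed;
    nonsingularity excludes the value 0 over \<open>P\<close>.\<close>
  define N where "N = {p \<in> {a..b} \<times> ?S. q p \<le> 0}"
  have comp: "compact ({a..b} \<times> ?S)" by (intro compact_Times) auto
  have "continuous_on ({a..b} \<times> ?S) q" by (rule continuous_on_subset[OF q]) auto
  from continuous_closed_preimage[OF this compact_imp_closed[OF comp] closed_atMost[of 0]]
  have "closed N" by (simp add: N_def vimage_def Int_def)
  then have "compact (({a..b} \<times> ?S) \<inter> N)" by (rule compact_Int_closed[OF comp])
  moreover have "({a..b} \<times> ?S) \<inter> N = N" by (auto simp: N_def)
  ultimately have clN: "closed (fst ` N)"
    by (intro compact_imp_closed compact_continuous_image continuous_intros) auto
  have N: "fst ` N = {a..b} - P"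
  proof (intro equalityI subsetI)
    fix s assume "s \<in> fst ` N"
    then obtain v where s: "s \<in> {a..b}" and v: "norm v = 1" "v \<bullet> (M s *v v) \<le> 0"
      by (auto simp: N_def q_def)
    have "\<not> positive_semidefinite (M s)"
    proof
      assume psd: "positive_semidefinite (M s)"
      then have "v \<bullet> (M s *v v) = 0"
        using v(2) unfolding positive_semidefinite_def by (meson order.antisym)
      then have "v = 0" using nonsing[OF s] positive_semidefinite_null[OF psd] by blast
      then show False using v(1) by simp
    qed
    then show "s \<in> {a..b} - P" using s by (simp add: P_def)
  next
    fix s assume s: "s \<in> {a..b} - P"
    then have "\<not> (\<forall>v. 0 \<le> v \<bullet> (M s *v v))"
      using sym[of s] by (simp add: P_def positive_semidefinite_def)
    then have "\<not> (\<forall>v\<in>?S. 0 \<le> v \<bullet> (M s *v v))"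
      using quadratic_form_sphere[of "M s"] by blast
    then obtain v where "v \<in> ?S" "v \<bullet> (M s *v v) < 0" by (auto simp: not_le)
    then have "(s, v) \<in> N" using s by (simp add: N_def q_def)
    then show "s \<in> fst ` N" by force
  qed
  have "connected {a..b}" by simp
  then have "P \<inter> {a..b} = {} \<or> fst ` N \<inter> {a..b} = {}"
    using connected_closedD[of "{a..b}" P "fst ` N"] clP clN unfolding N by blast
  then have "a \<in> P \<longleftrightarrow> b \<in> P"
    using \<open>a \<le> b\<close> unfolding N by (auto simp: disjoint_iff)
  then show ?thesis using \<open>a \<le> b\<close> by (simp add: P_def)
qed

section \<open>Moments and the binomial series\<close>

text \<open>Pair \<open>v\<close> with the polynomial vanishing at all nodes except
  \<open>x i\<close>. Its degree is below \<open>CARD('n)\<close>, so the pairing combines vanishing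
  moments, while only the term of \<open>v $ i\<close> survives.\<close>

lemma vandermonde_kernel:
  fixes x :: "'n::finite \<Rightarrow> real" and v :: "real ^ 'n"
  assumes "inj x" and "\<And>k. k < CARD('n) \<Longrightarrow> (\<Sum>i\<in>UNIV. v $ i * x i ^ k) = 0"
  shows "v = 0"
proof -
  have "v $ i = 0" for i
  proof -
    define P where "P = (\<Prod>j\<in>UNIV - {i}. [:- x j, 1:])"
    have deg: "degree P < CARD('n)"
      unfolding P_def by (subst degree_prod_eq_sum_degree) (auto simp: card_Diff_singleton)
    have P: "poly P (x j) = 0" if "j \<noteq> i" for j
      using that unfolding P_def poly_prod by (intro prod_zero) auto
    have "v $ i * poly P (x i) = (\<Sum>j\<in>UNIV. v $ j * poly P (x j))"
      using P by (subst sum.remove[of _ i]) auto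
    also have "\<dots> = (\<Sum>j\<in>UNIV. \<Sum>k\<le>degree P. coeff P k * (v $ j * x j ^ k))"
      by (simp add: poly_altdef sum_distrib_left mult_ac)
    also have "\<dots> = (\<Sum>k\<le>degree P. coeff P k * (\<Sum>j\<in>UNIV. v $ j * x j ^ k))"
      by (subst sum.swap) (simp add: sum_distrib_left)
    also have "\<dots> = 0" using assms(2) deg by (intro sum.neutral) auto
    finally show ?thesis
      using \<open>inj x\<close> by (auto simp: P_def poly_prod inj_eq)
  qed
  then show ?thesis by (simp add: vec_eq_iff)
qed

lemma moments_surjective:
  fixes x :: "'n::finite \<Rightarrow> real" and y :: "nat \<Rightarrow> real"
  assumes "inj x"
  obtains v :: "real ^ 'n" where "\<And>k. k < CARD('n) \<Longrightarrow> (\<Sum>i\<in>UNIV. v $ i * x i ^ k) = y k"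
proof -
  \<comment> \<open>Enumerating the index type turns the moments into a linear endomorphism of
    \<open>real ^ 'n\<close>, for which injectivity implies surjectivity.\<close>
  obtain h :: "'n \<Rightarrow> nat" where h: "bij_betw h UNIV {0..<CARD('n)}"
    using ex_bij_betw_finite_nat[of "UNIV :: 'n set"] by auto
  define T where "T = (\<lambda>v :: real ^ 'n. \<chi> l. \<Sum>i\<in>UNIV. v $ i * x i ^ h l)"
  have lin: "linear T"
    by (rule linearI) (auto simp: T_def vec_eq_iff sum.distrib algebra_simps sum_distrib_left)
  have "inj T"
  proof (subst linear_injective_0[OF lin], intro allI impI)
    fix v assume v: "T v = 0"
    show "v = 0"
    proof (rule vandermonde_kernel[OF assms])
      fix k assume "k < CARD('n)"
      then obtain l where "k = h l" using h by (auto simp: bij_betw_def image_iff set_eq_iff)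
      then show "(\<Sum>i\<in>UNIV. v $ i * x i ^ k) = 0" using v by (simp add: T_def vec_eq_iff)
    qed
  qed
  then have "surj T" using lin linear_injective_imp_surjective by blast
  then obtain v where v: "T v = (\<chi> l. y (h l))" by (metis surjD)
  show thesis
  proof (rule that)
    fix k assume "k < CARD('n)"
    then obtain l where "k = h l" using h by (auto simp: bij_betw_def image_iff set_eq_iff)
    then show "(\<Sum>i\<in>UNIV. v $ i * x i ^ k) = y k" using v by (simp add: T_def vec_eq_iff)
  qed
qed

text \<open>For each \<open>k\<close> the matrix with entries \<open>(x i * x j) ^ k\<close> is an
  outer product of a vector with itself, so its form is the square of a moment.\<close>

lemma quadratic_form_moments:
  fixes x :: "'n::finite \<Rightarrow> real" and v :: "real ^ 'n"
  shows "(\<Sum>i\<in>UNIV. \<Sum>j\<in>UNIV. v $ i * v $ j * (\<Sum>k\<in>K. c k * (x i * x j) ^ k))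
    = (\<Sum>k\<in>K. c k * (\<Sum>i\<in>UNIV. v $ i * x i ^ k)\<^sup>2)"
proof -
  have "(\<Sum>i\<in>UNIV. \<Sum>j\<in>UNIV. v $ i * v $ j * (\<Sum>k\<in>K. c k * (x i * x j) ^ k))
      = (\<Sum>i\<in>UNIV. \<Sum>j\<in>UNIV. \<Sum>k\<in>K. c k * ((v $ i * x i ^ k) * (v $ j * x j ^ k)))"
    by (simp add: sum_distrib_left power_mult_distrib mult_ac)
  also have "\<dots> = (\<Sum>i\<in>UNIV. \<Sum>k\<in>K. \<Sum>j\<in>UNIV. c k * ((v $ i * x i ^ k) * (v $ j * x j ^ k)))"
    by (rule sum.cong[OF refl], rule sum.swap)
  also have "\<dots> = (\<Sum>k\<in>K. \<Sum>i\<in>UNIV. \<Sum>j\<in>UNIV. c k * ((v $ i * x i ^ k) * (v $ j * x j ^ k)))"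
    by (rule sum.swap)
  also have "\<dots> = (\<Sum>k\<in>K. c k * (\<Sum>i\<in>UNIV. v $ i * x i ^ k)\<^sup>2)"
    unfolding power2_eq_square sum_product by (simp only: sum_distrib_left)
  finally show ?thesis .
qed

lemma quadratic_form_hadamard:
  "v \<bullet> (hadamard_power (\<chi> i j. f i j) r *v v)
    = (\<Sum>i\<in>UNIV. \<Sum>j\<in>UNIV. v $ i * v $ j * f i j powr r)"
  by (simp add: inner_vec_def matrix_vector_mult_def hadamard_power_def sum_distrib_left mult_ac)

text \<open>Pull \<open>\<bar>u\<bar> ^ m\<close> out of the tail and bound what is left by its
  absolute series at \<open>1 / 2\<close>; the constant is then independent of
  \<open>u\<close>.\<close>

lemma binomial_series_remainder:
  fixes r :: real
  obtains C where "C \<ge> 0"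
    "\<And>u. \<bar>u\<bar> \<le> 1 / 2 \<Longrightarrow> \<bar>(1 + u) powr r - (\<Sum>k<m. (r gchoose k) * u ^ k)\<bar> \<le> C * \<bar>u\<bar> ^ m"
proof -
  define c where "c = (\<lambda>k. r gchoose k)"
  have ser: "(\<lambda>k. c k * u ^ k) sums (1 + u) powr r" if "\<bar>u\<bar> < 1" for u
    unfolding c_def by (rule gen_binomial_real[OF that])
  \<comment> \<open>Convergence at \<open>3 / 4\<close>, strictly between \<open>1 / 2\<close> and
    1, yields absolute convergence at \<open>1 / 2\<close>.\<close>
  have "summable (\<lambda>k. norm (c k * (1 / 2) ^ k))"
    by (rule powser_insidea[of _ "3 / 4"]) (use ser[of "3 / 4"] in \<open>auto simp: sums_iff\<close>)
  then have "summable (\<lambda>k. \<bar>c k\<bar> * (1 / 2) ^ k)" by (simp add: abs_mult)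
  then have "summable (\<lambda>k. \<bar>c (k + m)\<bar> * (1 / 2) ^ (k + m))" by (subst summable_iff_shift)
  then have "summable (\<lambda>k. \<bar>c (k + m)\<bar> * (1 / 2) ^ (k + m) * 2 ^ m)" by (rule summable_mult2)
  then have sum: "summable (\<lambda>k. \<bar>c (k + m)\<bar> * (1 / 2) ^ k)"
    by (simp add: power_add power_one_over)
  show thesis
  proof (rule that)
    show "(\<Sum>k. \<bar>c (k + m)\<bar> * (1 / 2) ^ k) \<ge> 0" by (intro suminf_nonneg sum) auto
    fix u :: real assume u: "\<bar>u\<bar> \<le> 1 / 2"
    then have s: "(\<lambda>k. c k * u ^ k) sums (1 + u) powr r" by (intro ser) auto
    have le: "norm (c (k + m) * u ^ (k + m)) \<le> \<bar>c (k + m)\<bar> * (1 / 2) ^ k * \<bar>u\<bar> ^ m" for k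
      using power_mono[OF u, of k]
      by (simp add: abs_mult power_add power_abs mult.assoc mult_left_mono mult_right_mono)
    have sum': "summable (\<lambda>k. \<bar>c (k + m)\<bar> * (1 / 2) ^ k * \<bar>u\<bar> ^ m)"
      using sum by (rule summable_mult2)
    have "(1 + u) powr r - (\<Sum>k<m. c k * u ^ k) = (\<Sum>k. c (k + m) * u ^ (k + m))"
      using suminf_split_initial_segment[of "\<lambda>k. c k * u ^ k" m] s by (simp add: sums_iff)
    also have "\<bar>\<dots>\<bar> \<le> (\<Sum>k. \<bar>c (k + m)\<bar> * (1 / 2) ^ k * \<bar>u\<bar> ^ m)"
      using norm_suminf_le[OF le sum'] by simp
    also have "\<dots> = (\<Sum>k. \<bar>c (k + m)\<bar> * (1 / 2) ^ k) * \<bar>u\<bar> ^ m"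
      by (rule suminf_mult2[OF sum, symmetric])
    finally show "\<bar>(1 + u) powr r - (\<Sum>k<m. (r gchoose k) * u ^ k)\<bar>
      \<le> (\<Sum>k. \<bar>c (k + m)\<bar> * (1 / 2) ^ k) * \<bar>u\<bar> ^ m" by (simp add: c_def)
  qed
qed

text \<open>The remainder is estimated entry by entry. Uniformity in \<open>v\<close> lets one small
  \<open>s\<close> serve the whole unit sphere.\<close>

lemma quadratic_form_expansion:
  fixes x :: "'n::finite \<Rightarrow> real" and r :: real
  assumes x: "\<And>i. x i > 0"
  obtains C d where "C \<ge> 0" "0 < d" "d \<le> 1"
    "\<And>s v. 0 < s \<Longrightarrow> s \<le> d \<Longrightarrow>
      \<bar>v \<bullet> (hadamard_power (\<chi> i j. 1 + s * (x i * x j)) r *v v)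
        - (\<Sum>k<m. (r gchoose k) * s ^ k * (\<Sum>i\<in>UNIV. v $ i * x i ^ k)\<^sup>2)\<bar>
      \<le> C * s ^ m * (norm v)\<^sup>2"
proof -
  obtain C where C: "C \<ge> 0" "\<And>u. \<bar>u\<bar> \<le> 1 / 2 \<Longrightarrow>
      \<bar>(1 + u) powr r - (\<Sum>k<m. (r gchoose k) * u ^ k)\<bar> \<le> C * \<bar>u\<bar> ^ m"
    using binomial_series_remainder by blast
  \<comment> \<open>\<open>B\<close> bounds every \<open>x i\<close>, and its summand 1 ensures
    \<open>B \<ge> 1\<close>. For \<open>s \<le> 1 / (2 * B\<^sup>2)\<close> all arguments
    \<open>s * (x i * x j)\<close> are at most \<open>1 / 2\<close>. The factor
    \<open>n\<^sup>2\<close> in the final constant counts the entries.\<close>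
  define B where "B = 1 + (\<Sum>i\<in>UNIV. x i)"
  have xB: "x i \<le> B" for i
    unfolding B_def using member_le_sum[of i UNIV x] x by (simp add: less_imp_le)
  have B1: "B \<ge> 1" unfolding B_def using x by (simp add: sum_nonneg less_imp_le)
  define n where "n = real CARD('n)"
  show thesis
  proof (rule that)
    show "n\<^sup>2 * C * (B\<^sup>2) ^ m \<ge> 0" using C(1) by simp
    show "0 < 1 / (2 * B\<^sup>2)" using B1 by simp
    have "1 \<le> 2 * B\<^sup>2" using one_le_power[OF B1, of 2] by linarith
    then show "1 / (2 * B\<^sup>2) \<le> 1" using divide_le_eq_1_pos[of "2 * B\<^sup>2" 1] by linarith
    fix s :: real and v :: "real ^ 'n" assume s: "0 < s" "s \<le> 1 / (2 * B\<^sup>2)"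
    define e where "e = (\<lambda>i j. (1 + s * (x i * x j)) powr r - (\<Sum>k<m. (r gchoose k) * (s * (x i * x j)) ^ k))"
    have e: "\<bar>v $ i * v $ j * e i j\<bar> \<le> (norm v)\<^sup>2 * (C * (s * B\<^sup>2) ^ m)" for i j
    proof -
      have xx: "0 < x i * x j" "x i * x j \<le> B\<^sup>2"
        using x[of i] x[of j] xB[of i] xB[of j] by (auto simp: power2_eq_square intro: mult_mono less_imp_le)
      then have u: "0 < s * (x i * x j)" "s * (x i * x j) \<le> s * B\<^sup>2" using s by auto
      have "s * B\<^sup>2 \<le> 1 / 2" using s(2) B1 by (simp add: field_simps)
      then have "\<bar>e i j\<bar> \<le> C * \<bar>s * (x i * x j)\<bar> ^ m" unfolding e_def using u by (intro C(2)) auto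
      also have "\<dots> \<le> C * (s * B\<^sup>2) ^ m" using u C(1) by (intro mult_left_mono power_mono) auto
      finally have *: "\<bar>e i j\<bar> \<le> C * (s * B\<^sup>2) ^ m" .
      show ?thesis unfolding abs_mult power2_eq_square[of "norm v"]
        using component_le_norm_cart[of v]
        by (intro mult_mono *) auto
    qed
    have "v \<bullet> (hadamard_power (\<chi> i j. 1 + s * (x i * x j)) r *v v)
        - (\<Sum>k<m. (r gchoose k) * s ^ k * (\<Sum>i\<in>UNIV. v $ i * x i ^ k)\<^sup>2)
        = (\<Sum>i\<in>UNIV. \<Sum>j\<in>UNIV. v $ i * v $ j * e i j)"
      unfolding quadratic_form_hadamard quadratic_form_moments[symmetric] e_def
      by (simp add: sum_subtractf right_diff_distrib power_mult_distrib mult_ac)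
    also have "\<bar>\<dots>\<bar> \<le> (\<Sum>i\<in>(UNIV::'n set). \<Sum>j\<in>(UNIV::'n set). (norm v)\<^sup>2 * (C * (s * B\<^sup>2) ^ m))"
      by (rule order_trans[OF sum_abs sum_mono], rule order_trans[OF sum_abs sum_mono]) (rule e)
    also have "\<dots> = n\<^sup>2 * C * (B\<^sup>2) ^ m * s ^ m * (norm v)\<^sup>2"
      by (simp add: n_def power2_eq_square power_mult_distrib mult_ac)
    finally show "\<bar>v \<bullet> (hadamard_power (\<chi> i j. 1 + s * (x i * x j)) r *v v)
        - (\<Sum>k<m. (r gchoose k) * s ^ k * (\<Sum>i\<in>UNIV. v $ i * x i ^ k)\<^sup>2)\<bar>
      \<le> n\<^sup>2 * C * (B\<^sup>2) ^ m * s ^ m * (norm v)\<^sup>2" .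
  qed
qed

lemma gbinomial_pos:
  fixes r :: real
  assumes "real k < r + 1"
  shows "r gchoose k > 0"
  using assms by (auto simp: gbinomial_prod_rev intro!: divide_pos_pos prod_pos)

text \<open>With \<open>f = nat \<lfloor>r\<rfloor>\<close>, the factors \<open>r - real i\<close>
  are positive for \<open>i \<le> f\<close>, and only the last one, for \<open>i = f + 1\<close>, is
  negative.\<close>

lemma gbinomial_floor_neg:
  fixes r :: real
  assumes "r \<ge> 0" "r \<notin> \<nat>"
  shows "r gchoose (nat \<lfloor>r\<rfloor> + 2) < 0"
proof -
  define f where "f = nat \<lfloor>r\<rfloor>"
  have "real f \<noteq> r" using assms(2) by (metis of_nat_in_Nats)
  then have f: "real f < r" "r < real f + 1"
    using assms(1) unfolding f_def by linarith+
  have "(\<Prod>i = 0..<f + 1. r - real i) > 0" using f by (intro prod_pos) auto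
  then have "(\<Prod>i = 0..<f + 2. r - real i) < 0"
    using f by (simp add: numeral_2_eq_2 mult_pos_neg)
  then show ?thesis by (simp add: gbinomial_prod_rev divide_neg_pos flip: f_def del: prod.op_ivl_Suc)
qed

section \<open>Hadamard powers\<close>

lemma transpose_hadamard_power_scaled:
  "transpose (hadamard_power (\<chi> i j. 1 + s * (x i * x j)) r) = hadamard_power (\<chi> i j. 1 + s * (x i * x j)) r"
  by (simp add: transpose_def hadamard_power_def vec_eq_iff mult.commute)

text \<open>Each row of \<open>M t *v v = 0\<close> says that the combination with coefficients
  \<open>v $ j\<close> vanishes at \<open>z = t * x i\<close>. These are \<open>CARD('n)\<close>
  distinct positive zeros, so \<open>v = 0\<close> and the path is nonsingular.\<close>

lemma hadamard_power_path:
  fixes x :: "'n::finite \<Rightarrow> real" and r s :: real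
  assumes "inj x" and x: "\<And>i. x i > 0"
    and r: "\<And>k. k + 2 \<le> CARD('n) \<Longrightarrow> r \<noteq> real k" and "0 < s" "s \<le> 1"
  shows "positive_semidefinite (hadamard_power (\<chi> i j. 1 + s * (x i * x j)) r)
    \<longleftrightarrow> positive_semidefinite (hadamard_power (\<chi> i j. 1 + x i * x j) r)"
proof -
  define M where "M = (\<lambda>t. hadamard_power (\<chi> i j. 1 + t * (x i * x j)) r)"
  have "positive_semidefinite (M s) \<longleftrightarrow> positive_semidefinite (M 1)"
  proof (rule positive_semidefinite_path[OF \<open>s \<le> 1\<close>])
    have "1 + t * (x i * x j) \<noteq> 0" if "t \<in> {s..1}" for t i j
      using that x[of i] x[of j] \<open>0 < s\<close> by (smt (verit) atLeastAtMost_iff mult_pos_pos)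
    then show "continuous_on {s..1} M"
      unfolding M_def hadamard_power_def by (intro continuous_intros) auto
    fix t assume t: "t \<in> {s..1}"
    show "transpose (M t) = M t" unfolding M_def by (rule transpose_hadamard_power_scaled)
    fix v assume v: "M t *v v = 0"
    have "t > 0" using t \<open>0 < s\<close> by simp
    have "v $ j = 0" for j
    proof (rule powr_combination_zeros[where J = UNIV and b = x and Z = "(\<lambda>i. t * x i) ` UNIV" and r = r])
      show "card (UNIV :: 'n set) \<le> card ((\<lambda>i. t * x i) ` UNIV)"
        using \<open>inj x\<close> \<open>t > 0\<close> by (subst card_image) (auto simp: inj_def)
      show "(\<Sum>j\<in>UNIV. v $ j * (1 + z * x j) powr r) = 0" if "z \<in> (\<lambda>i. t * x i) ` UNIV" for z
      proof -
        from that obtain i where "z = t * x i" by auto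
        moreover have "(M t *v v) $ i = 0" using v by simp
        ultimately show ?thesis
          by (simp add: M_def hadamard_power_def matrix_vector_mult_def mult_ac)
      qed
    qed (use \<open>inj x\<close> x \<open>t > 0\<close> r in auto)
    then show "v = 0" by (simp add: vec_eq_iff)
  qed
  then show ?thesis by (simp add: M_def)
qed

text \<open>The binomial theorem gives squared moments with nonnegative coefficients.\<close>

lemma positive_semidefinite_hadamard_power_nat:
  fixes x :: "'n::finite \<Rightarrow> real"
  assumes x: "\<And>i. x i > 0"
  shows "positive_semidefinite (hadamard_power (\<chi> i j. 1 + x i * x j) (real m))"
proof -
  have "v \<bullet> (hadamard_power (\<chi> i j. 1 + x i * x j) (real m) *v v) \<ge> 0" for v
  proof -
    have "(1 + x i * x j) powr real m = (\<Sum>k\<le>m. real (m choose k) * (x i * x j) ^ k)" for i j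
    proof -
      have "1 + x i * x j > 0" using x by (simp add: add_pos_pos)
      then show ?thesis using binomial_ring[of "x i * x j" 1 m] by (simp add: powr_realpow add.commute)
    qed
    then have "v \<bullet> (hadamard_power (\<chi> i j. 1 + x i * x j) (real m) *v v)
        = (\<Sum>k\<le>m. real (m choose k) * (\<Sum>i\<in>UNIV. v $ i * x i ^ k)\<^sup>2)"
      by (simp add: quadratic_form_hadamard quadratic_form_moments)
    then show ?thesis by (simp add: sum_nonneg)
  qed
  then show ?thesis
    using transpose_hadamard_power_scaled[of 1 x "real m"] by (simp add: positive_semidefinite_def)
qed

text \<open>With \<open>n = CARD('n)\<close>, the truncated form is at least
  \<open>s ^ (n - 1) * Q v\<close> on the unit sphere, where \<open>Q\<close> has a positive
  minimum. The remainder is at most \<open>C * s ^ n\<close>, which is dominated for small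
  \<open>s\<close>.\<close>

lemma positive_semidefinite_small_scale:
  fixes x :: "'n::finite \<Rightarrow> real" and r :: real
  assumes "inj x" and x: "\<And>i. x i > 0" and r: "r > real CARD('n) - 2"
  obtains s where "0 < s" "s \<le> 1"
    "positive_semidefinite (hadamard_power (\<chi> i j. 1 + s * (x i * x j)) r)"
proof -
  let ?n = "CARD('n)" and ?S = "sphere (0 :: real ^ 'n) 1"
  obtain C d where C: "C \<ge> 0" "0 < d" "d \<le> 1"
    "\<And>s v. 0 < s \<Longrightarrow> s \<le> d \<Longrightarrow>
      \<bar>v \<bullet> (hadamard_power (\<chi> i j. 1 + s * (x i * x j)) r *v v)
        - (\<Sum>k<?n. (r gchoose k) * s ^ k * (\<Sum>i\<in>UNIV. v $ i * x i ^ k)\<^sup>2)\<bar>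
      \<le> C * s ^ ?n * (norm v)\<^sup>2"
    by (rule quadratic_form_expansion[OF x, where m = "CARD('n)" and r = r]) (rule that)
  define Q where "Q = (\<lambda>v :: real ^ 'n. \<Sum>k<?n. (r gchoose k) * (\<Sum>i\<in>UNIV. v $ i * x i ^ k)\<^sup>2)"
  have pos: "r gchoose k > 0" if "k < ?n" for k using that r by (intro gbinomial_pos) linarith
  have "continuous_on ?S Q" unfolding Q_def by (intro continuous_intros)
  moreover have "?S \<noteq> {}" by simp
  ultimately obtain w where w: "w \<in> ?S" "\<And>v. v \<in> ?S \<Longrightarrow> Q w \<le> Q v"
    using continuous_attains_inf[of ?S Q] by auto
  have "Q w > 0"
  proof -
    have "w \<noteq> 0" using w(1) by auto
    then obtain k where k: "k < ?n" "(\<Sum>i\<in>UNIV. w $ i * x i ^ k) \<noteq> 0"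
      using vandermonde_kernel[OF \<open>inj x\<close>, of w] by blast
    then have "0 < (r gchoose k) * (\<Sum>i\<in>UNIV. w $ i * x i ^ k)\<^sup>2" using pos by simp
    also have "\<dots> \<le> Q w" unfolding Q_def
      using pos k(1) by (intro member_le_sum) (auto simp: less_imp_le)
    finally show ?thesis .
  qed
  \<comment> \<open>Chosen to give \<open>C * s \<le> Q w\<close>; the \<open>+ 1\<close> covers
    \<open>C = 0\<close>.\<close>
  define s where "s = min d (Q w / (C + 1))"
  have s: "0 < s" "s \<le> d" using C \<open>Q w > 0\<close> by (auto simp: s_def)
  have "C * s \<le> Q w"
  proof -
    have "s \<le> Q w / (C + 1)" by (simp add: s_def)
    then have "(C + 1) * s \<le> Q w" using C(1) by (simp add: field_simps)
    then show ?thesis using s by (simp add: algebra_simps)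
  qed
  have "v \<bullet> (hadamard_power (\<chi> i j. 1 + s * (x i * x j)) r *v v) \<ge> 0" if v: "v \<in> ?S" for v
  proof -
    have "C * s ^ ?n = s ^ (?n - 1) * (C * s)" by (cases "?n") auto
    also have "\<dots> \<le> s ^ (?n - 1) * Q v"
      using \<open>C * s \<le> Q w\<close> w(2)[OF v] s by (intro mult_left_mono) auto
    also have "\<dots> \<le> (\<Sum>k<?n. (r gchoose k) * s ^ k * (\<Sum>i\<in>UNIV. v $ i * x i ^ k)\<^sup>2)"
      unfolding Q_def sum_distrib_left
    proof (intro sum_mono)
      fix k assume k: "k \<in> {..<?n}"
      have "s ^ (?n - 1) \<le> s ^ k" using k s C(3) by (intro power_decreasing) auto
      then have "s ^ (?n - 1) * ((r gchoose k) * (\<Sum>i\<in>UNIV. v $ i * x i ^ k)\<^sup>2)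
          \<le> s ^ k * ((r gchoose k) * (\<Sum>i\<in>UNIV. v $ i * x i ^ k)\<^sup>2)"
        using pos[of k] k by (intro mult_right_mono) auto
      then show "s ^ (?n - 1) * ((r gchoose k) * (\<Sum>i\<in>UNIV. v $ i * x i ^ k)\<^sup>2)
          \<le> (r gchoose k) * s ^ k * (\<Sum>i\<in>UNIV. v $ i * x i ^ k)\<^sup>2" by (simp add: mult_ac)
    qed
    finally show ?thesis using C(4)[OF s, of v] v by simp
  qed
  then have "positive_semidefinite (hadamard_power (\<chi> i j. 1 + s * (x i * x j)) r)"
    using quadratic_form_sphere transpose_hadamard_power_scaled
    unfolding positive_semidefinite_def by blast
  then show thesis using that s C(3) by auto
qed

text \<open>Take \<open>v\<close> with all moments of order at most
  \<open>m = nat \<lfloor>r\<rfloor> + 2\<close> zero except the last. The form is then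
  \<open>(r gchoose m) * s ^ m\<close> up to order \<open>s ^ Suc m\<close>, with a negative leading
  coefficient.\<close>

lemma not_positive_semidefinite_small_scale:
  fixes x :: "'n::finite \<Rightarrow> real" and r :: real
  assumes "inj x" and x: "\<And>i. x i > 0"
    and "r \<ge> 0" "r \<notin> \<nat>" "r \<le> real CARD('n) - 2"
  obtains s where "0 < s" "s \<le> 1"
    "\<not> positive_semidefinite (hadamard_power (\<chi> i j. 1 + s * (x i * x j)) r)"
proof -
  define m where "m = nat \<lfloor>r\<rfloor> + 2"
  \<comment> \<open>Nonintegrality makes \<open>\<lfloor>r\<rfloor>\<close> strictly less than
    \<open>CARD('n) - 2\<close>, so the moment of order \<open>m\<close> can still be
    prescribed.\<close>
  have "r \<noteq> real_of_int \<lfloor>r\<rfloor>"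
    using assms(3,4) by (metis of_nat_in_Nats of_nat_nat zero_le_floor)
  then have m: "m < CARD('n)"
    using assms(3,5) unfolding m_def by linarith
  have neg: "r gchoose m < 0" unfolding m_def by (rule gbinomial_floor_neg[OF assms(3,4)])
  obtain v :: "real ^ 'n" where
      "\<And>k. k < CARD('n) \<Longrightarrow> (\<Sum>i\<in>UNIV. v $ i * x i ^ k) = (if k = m then 1 else 0)"
    using moments_surjective[OF \<open>inj x\<close>, of "\<lambda>k. if k = m then 1 else 0"] by blast
  then have v: "(\<Sum>i\<in>UNIV. v $ i * x i ^ k) = (if k = m then 1 else 0)" if "k \<le> m" for k
    using that m by simp
  obtain C d where C: "C \<ge> 0" "0 < d" "d \<le> 1"
    "\<And>s v. 0 < s \<Longrightarrow> s \<le> d \<Longrightarrow>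
      \<bar>v \<bullet> (hadamard_power (\<chi> i j. 1 + s * (x i * x j)) r *v v)
        - (\<Sum>k<Suc m. (r gchoose k) * s ^ k * (\<Sum>i\<in>UNIV. v $ i * x i ^ k)\<^sup>2)\<bar>
      \<le> C * s ^ Suc m * (norm v)\<^sup>2"
    by (rule quadratic_form_expansion[OF x, where m = "Suc m" and r = r]) (rule that)
  define D where "D = C * (norm v)\<^sup>2"
  have D: "D \<ge> 0" using C(1) by (simp add: D_def)
  \<comment> \<open>The resulting bound \<open>(D + 1) * s \<le> - (r gchoose m)\<close> leaves a
    strict margin \<open>s\<close> over the error \<open>D * s\<close>.\<close>
  define s where "s = min d (- (r gchoose m) / (D + 1))"
  have s: "0 < s" "s \<le> d" using C D neg by (auto simp: s_def intro: divide_neg_pos)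
  have "(D + 1) * s \<le> - (r gchoose m)"
  proof -
    have "s \<le> - (r gchoose m) / (D + 1)" by (simp add: s_def)
    then show ?thesis using D by (simp add: field_simps)
  qed
  then have "(r gchoose m) + D * s < 0" using s by (simp add: algebra_simps)
  then have "s ^ m * ((r gchoose m) + D * s) < 0" using s by (intro mult_pos_neg) auto
  moreover have "(\<Sum>k<Suc m. (r gchoose k) * s ^ k * (\<Sum>i\<in>UNIV. v $ i * x i ^ k)\<^sup>2) = (r gchoose m) * s ^ m"
    by (simp add: v)
  ultimately have "v \<bullet> (hadamard_power (\<chi> i j. 1 + s * (x i * x j)) r *v v) < 0"
    using C(4)[OF s, of v] by (simp add: D_def algebra_simps)
  then have "\<not> positive_semidefinite (hadamard_power (\<chi> i j. 1 + s * (x i * x j)) r)"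
    by (auto simp: positive_semidefinite_def not_le)
  then show thesis using that s C(3) by auto
qed

theorem theorem1p1:
  fixes x :: "'n::finite \<Rightarrow> real" and r :: real
  assumes "inj x"
    and "\<And>i. x i > 0"
    and "r \<ge> 0"
  shows "positive_semidefinite (hadamard_power (\<chi> i j. 1 + x i * x j) r)
    \<longleftrightarrow> r \<in> \<nat> \<or> r > real CARD('n) - 2"
proof (cases "r \<in> \<nat>")
  case True
  \<comment> \<open>Integers up to \<open>CARD('n) - 2\<close> are excluded from the path argument,
    so natural exponents are treated directly.\<close>
  then obtain m where "r = real m" by (auto elim: Nats_cases)
  then show ?thesis using True positive_semidefinite_hadamard_power_nat[OF assms(2)] by simp
next
  case False
  \<comment> \<open>A nonintegral exponent avoids every excluded value, so the scale may be taken
    small.\<close>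
  then have "r \<noteq> real k" for k by auto
  note path = hadamard_power_path[OF assms(1,2) this]
  show ?thesis
  proof (cases "r > real CARD('n) - 2")
    case True
    then show ?thesis
      using positive_semidefinite_small_scale[OF assms(1,2) True] path by metis
  next
    case small: False
    then have "r \<le> real CARD('n) - 2" by simp
    then show ?thesis
      using not_positive_semidefinite_small_scale[OF assms(1-3) False] path False small by metis
  qed
qed

end
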